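(* For every finite nonempty semimetric space $X$ and every $\varepsilon>0$ there are spaces $Y$, $Z$ and mappings $F\colon Y\to X$ and $\Phi\colon Z\to Y$ such that $Y$ is a finite ultrametric space, $Z\in\mathfrak{U}$, $F$ is ball-preserving, $\Phi$ is an $\varepsilon$-isometry, and $$X=F(\Phi(Z)).$$
   Context: A semimetric on a set $X$ is a function $d\colon X\times X\to[0,\infty)$ with $d(x,y)=d(y,x)$ and $d(x,y)=0\Leftrightarrow x=y$ for all $x,y\in X$; then $(X,d)$ is a semimetric space. An ultrametric is a semimetric satisfying $d(x,y)\leqslant\max\{d(x,z),d(z,y)\}$ for all $x,y,z$. The spectrum is $\operatorname{Sp}(X)=\{d(x,y)\colon x,y\in X\}$. $\mathfrak{U}$ is the class of finite ultrametric spaces $X$ with $|\operatorname{Sp}(X)|=|X|$. A closed ball in a semimetric space $(X,d)$ is a set of the form $B_r(t)=\{x\in X\colon d(x,t)\leqslant r\}$ with $t\in X$, $r\in[0,\infty)$; $\mathbf{B}_X$ is the set of all closed balls of $X$. A mapping $F\colon X\to Y$ between semimetric spaces is ball-preserving if $F(B)\in\mathbf{B}_Y$ for every $B\in\mathbf{B}_X$. For semimetric spaces $(X,d)$, $(Y,\rho)$ and $\varepsilon>0$, a surjective mapping $F\colon X\to Y$ is an $\varepsilon$-isometry if $|d(x,y)-\rho(F(x),F(y))|\leqslant\varepsilon$ for all $x,y\in X$. *)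

theory Defs
  imports Complex_Main "HOL-Library.FuncSet"
begin

text \<open>
  A space is a carrier set together with a distance function on the ambient type; values of the
  distance outside the carrier are irrelevant. The empty carrier is allowed, so nonemptiness
  is assumed explicitly where it is needed.
\<close>

locale semimetric_space =
  fixes X :: "'a set" and d :: "'a \<Rightarrow> 'a \<Rightarrow> real"
  assumes nonneg: "\<lbrakk>x \<in> X; y \<in> X\<rbrakk> \<Longrightarrow> 0 \<le> d x y"
    and commute: "\<lbrakk>x \<in> X; y \<in> X\<rbrakk> \<Longrightarrow> d x y = d y x"
    and zero_iff: "\<lbrakk>x \<in> X; y \<in> X\<rbrakk> \<Longrightarrow> d x y = 0 \<longleftrightarrow> x = y"

locale ultrametric_space = semimetric_space +
  assumes strong_triangle:
    "\<lbrakk>x \<in> X; y \<in> X; z \<in> X\<rbrakk> \<Longrightarrow> d x y \<le> max (d x z) (d z y)"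

definition spectrum :: "'a set \<Rightarrow> ('a \<Rightarrow> 'a \<Rightarrow> real) \<Rightarrow> real set" where
  "spectrum X d = {d x y | x y. x \<in> X \<and> y \<in> X}"

text \<open>Membership in the class \<open>\<UU>\<close> of finite ultrametric spaces with as many distances
  (including the distance 0) as points.\<close>

definition in_class_U :: "'a set \<Rightarrow> ('a \<Rightarrow> 'a \<Rightarrow> real) \<Rightarrow> bool" where
  "in_class_U X d \<longleftrightarrow> finite X \<and> ultrametric_space X d \<and> card (spectrum X d) = card X"

definition closed_ball :: "'a set \<Rightarrow> ('a \<Rightarrow> 'a \<Rightarrow> real) \<Rightarrow> 'a \<Rightarrow> real \<Rightarrow> 'a set" where
  "closed_ball X d t r = {x \<in> X. d x t \<le> r}"

definition closed_balls :: "'a set \<Rightarrow> ('a \<Rightarrow> 'a \<Rightarrow> real) \<Rightarrow> 'a set set" where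
  "closed_balls X d = {closed_ball X d t r | t r. t \<in> X \<and> 0 \<le> r}"

definition ball_preserving ::
    "'a set \<Rightarrow> ('a \<Rightarrow> 'a \<Rightarrow> real) \<Rightarrow> 'b set \<Rightarrow> ('b \<Rightarrow> 'b \<Rightarrow> real) \<Rightarrow> ('a \<Rightarrow> 'b) \<Rightarrow> bool" where
  "ball_preserving X d Y \<rho> F \<longleftrightarrow>
     F \<in> X \<rightarrow> Y \<and> (\<forall>B \<in> closed_balls X d. F ` B \<in> closed_balls Y \<rho>)"

definition eps_isometry ::
    "real \<Rightarrow> 'a set \<Rightarrow> ('a \<Rightarrow> 'a \<Rightarrow> real) \<Rightarrow> 'b set \<Rightarrow> ('b \<Rightarrow> 'b \<Rightarrow> real) \<Rightarrow> ('a \<Rightarrow> 'b) \<Rightarrow> bool" where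
  "eps_isometry \<epsilon> X d Y \<rho> F \<longleftrightarrow>
     F ` X = Y \<and> (\<forall>x \<in> X. \<forall>y \<in> X. \<bar>d x y - \<rho> (F x) (F y)\<bar> \<le> \<epsilon>)"

end

theory Submission
  imports Defs
begin

text \<open>
  Let \<open>Y\<close> be the equidistant space with as many points as \<open>X\<close>. Its balls are the singletons and
  the whole space, and so every bijection onto \<open>X\<close> preserves balls. Perturbing the common distance
  to \<open>1 + \<epsilon> * max i j / n\<close> keeps the space ultrametric and makes it a member of the
  class \<open>\<UU>\<close>.
\<close>

definition discrete_dist :: "'a \<Rightarrow> 'a \<Rightarrow> real" where
  "discrete_dist x y = (if x = y then 0 else 1)"

text \<open>For \<open>f\<close> the identity on the nonnegative reals this is the
  Delhomme-Laflamme-Pouzet-Sauer ultrametric.\<close>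

definition max_dist :: "('a::linorder \<Rightarrow> real) \<Rightarrow> 'a \<Rightarrow> 'a \<Rightarrow> real" where
  "max_dist f x y = (if x = y then 0 else f (max x y))"

lemma ultrametric_discrete_dist: "ultrametric_space X discrete_dist"
  by unfold_locales (auto simp: discrete_dist_def)

lemma closed_ball_discrete_dist:
  assumes "t \<in> X" and "0 \<le> r"
  shows "closed_ball X discrete_dist t r = (if r < 1 then {t} else X)"
  using assms by (auto simp: closed_ball_def discrete_dist_def)

text \<open>A monotone \<open>f\<close> commutes with \<open>max\<close>, so for distinct points the
  strong triangle inequality comes down to one between maxima in the linear order.\<close>

lemma ultrametric_max_dist:
  assumes "mono f" and "\<And>x. 0 < f x"
  shows "ultrametric_space X (max_dist f)"
proof unfold_locales
  fix x y z
  show "max_dist f x y \<le> max (max_dist f x z) (max_dist f z y)"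
  \<comment> \<open>If two points coincide, either the left side is 0 or it reappears on the
    right.\<close>
  proof (cases "x = y \<or> z = x \<or> z = y")
    case True
    then show ?thesis
      using assms(2) by (auto simp: max_dist_def less_imp_le le_max_iff_disj)
  next
    case False
    have "f (max x y) \<le> f (max (max x z) (max z y))"
      using \<open>mono f\<close> by (rule monoD) (auto simp: le_max_iff_disj)
    also have "\<dots> = max (f (max x z)) (f (max z y))"
      using \<open>mono f\<close> by (rule max_of_mono[symmetric])
    finally show ?thesis
      using False by (simp add: max_dist_def)
  qed
qed (use assms(2) in \<open>auto simp: max_dist_def max.commute less_imp_le less_imp_neq[THEN not_sym]\<close>)

text \<open>The larger of two distinct indices is at least 1, so \<open>f 0\<close> is never a
  distance. The \<open>n - 1\<close> values \<open>f k\<close> with \<open>1 \<le> k < n\<close> are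
  distinct and positive, and 0 makes \<open>n\<close> distances.\<close>

lemma in_class_U_max_dist:
  fixes f :: "nat \<Rightarrow> real"
  assumes f: "strict_mono f" and pos: "\<And>k. 0 < f k" and "0 < n"
  shows "in_class_U {..<n} (max_dist f)"
proof -
  have "spectrum {..<n} (max_dist f) = insert 0 (f ` {1..<n})"
  proof (intro equalityI subsetI)
    fix r assume "r \<in> spectrum {..<n} (max_dist f)"
    then obtain x y where "x < n" "y < n" "r = max_dist f x y"
      by (auto simp: spectrum_def)
    then show "r \<in> insert 0 (f ` {1..<n})"
      by (cases x y rule: linorder_cases) (auto simp: max_dist_def)
  next
    fix r assume "r \<in> insert 0 (f ` {1..<n})"
    \<comment> \<open>Distances from the point 0 already exhaust the spectrum; \<open>k = 0\<close>
      yields the distance 0.\<close>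
    then obtain k where "k \<in> {..<n}" "r = max_dist f 0 k"
      using \<open>0 < n\<close> by (force simp: max_dist_def)
    then show "r \<in> spectrum {..<n} (max_dist f)"
      using lessThan_iff \<open>0 < n\<close> unfolding spectrum_def by blast
  qed
  moreover have "card (f ` {1..<n}) = n - 1"
    using card_image[OF strict_mono_imp_inj_on[OF f]] by simp
  moreover have "0 \<notin> f ` {1..<n}"
    using pos by (metis imageE less_irrefl)
  ultimately show ?thesis
    using \<open>0 < n\<close> ultrametric_max_dist[OF strict_mono_mono[OF f] pos]
    by (simp add: in_class_U_def)
qed

context semimetric_space
begin

lemma singleton_in_closed_balls:
  assumes "x \<in> X"
  shows "{x} \<in> closed_balls X d"
proof -
  have "closed_ball X d x 0 = {x}"
    using assms nonneg zero_iff by (force simp: closed_ball_def)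
  then show ?thesis
    using assms by (force simp: closed_balls_def)
qed

lemma carrier_in_closed_balls:
  assumes "finite X" and "X \<noteq> {}"
  shows "X \<in> closed_balls X d"
proof -
  obtain t where t: "t \<in> X"
    using assms by blast
  \<comment> \<open>The largest distance from \<open>t\<close>, which exists by finiteness, is a
    radius that reaches every point.\<close>
  define r where "r = Max ((\<lambda>x. d x t) ` X)"
  have le: "d x t \<le> r" if "x \<in> X" for x
    using that assms by (simp add: r_def)
  moreover have "0 \<le> r"
    using le[OF t] nonneg[OF t t] by simp
  ultimately show ?thesis
    using t by (force simp: closed_balls_def closed_ball_def)
qed

lemma ball_preserving_discrete_dist:
  assumes "finite X" and "F ` Y = X"
  shows "ball_preserving Y discrete_dist X d F"
  unfolding ball_preserving_def
proof (intro conjI ballI)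
  show "F \<in> Y \<rightarrow> X"
    using assms by blast
next
  fix B assume "B \<in> closed_balls Y discrete_dist"
  \<comment> \<open>The centre \<open>t\<close> also shows, through \<open>F t\<close>, that
    \<open>X\<close> is nonempty, as \<open>carrier_in_closed_balls\<close> requires.\<close>
  then obtain t where "t \<in> Y" "B = {t} \<or> B = Y"
    by (auto simp: closed_balls_def closed_ball_discrete_dist split: if_splits)
  then show "F ` B \<in> closed_balls X d"
    using assms singleton_in_closed_balls carrier_in_closed_balls by auto
qed

end

theorem corollary4p6:
  fixes X :: "'a set" and d :: "'a \<Rightarrow> 'a \<Rightarrow> real" and \<epsilon> :: real
  assumes "semimetric_space X d" and "finite X" and "X \<noteq> {}" and "\<epsilon> > 0"
  shows "\<exists>(Y :: nat set) (\<rho> :: nat \<Rightarrow> nat \<Rightarrow> real) (Z :: nat set) (\<delta> :: nat \<Rightarrow> nat \<Rightarrow> real)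
            (F :: nat \<Rightarrow> 'a) (\<Phi> :: nat \<Rightarrow> nat).
           finite Y \<and> ultrametric_space Y \<rho> \<and> in_class_U Z \<delta> \<and>
           ball_preserving Y \<rho> X d F \<and> eps_isometry \<epsilon> Z \<delta> Y \<rho> \<Phi> \<and>
           X = F ` (\<Phi> ` Z)"
proof -
  define n where "n = card X"
  have n: "0 < n"
    using assms by (simp add: n_def card_gt_0_iff)
  obtain F where "bij_betw F {..<n} X"
    using ex_bij_betw_nat_finite[OF \<open>finite X\<close>] by (auto simp: n_def atLeast0LessThan)
  then have F: "F ` {..<n} = X"
    by (rule bij_betw_imp_surj_on)
  \<comment> \<open>The positive slope \<open>\<epsilon> / n\<close> separates the distances and
    keeps \<open>f k\<close> within \<epsilon> of 1 for all \<open>k < n\<close>.\<close>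
  define f where "f k = 1 + \<epsilon> * real k / real n" for k
  have "strict_mono f"
    using n \<open>\<epsilon> > 0\<close> by (auto simp: strict_mono_def f_def divide_strict_right_mono)
  moreover have "0 < f k" for k
    using \<open>\<epsilon> > 0\<close> by (simp add: f_def add_pos_nonneg)
  ultimately have "in_class_U {..<n} (max_dist f)"
    using n by (rule in_class_U_max_dist)
  moreover have "eps_isometry \<epsilon> {..<n} (max_dist f) {..<n} discrete_dist id"
  proof -
    \<comment> \<open>Off the diagonal the distances compared are \<open>f k\<close> and 1, where
      \<open>k < n\<close> is the larger index; on it both are 0.\<close>
    have "\<bar>f k - 1\<bar> \<le> \<epsilon>" if "k < n" for k
      using that \<open>\<epsilon> > 0\<close> by (simp add: f_def field_simps)
    then show ?thesis
      using \<open>\<epsilon> > 0\<close> by (simp add: eps_isometry_def max_dist_def discrete_dist_def)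
  qed
  moreover have "ball_preserving {..<n} discrete_dist X d F"
    using semimetric_space.ball_preserving_discrete_dist[OF assms(1,2) F] .
  moreover have "X = F ` (id ` {..<n})"
    using F by simp
  ultimately show ?thesis
    using ultrametric_discrete_dist finite_lessThan by blast
qed

end
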